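(* Let $\xi$ be a random variable with values in $\mathbb{N}_0$, with $p_k=\mathbb{P}(\xi=k)$ and probability generating function $g(x)=\sum_{k\ge 0}p_kx^k$. Consider the $(1,1)$ Maker-Breaker game on the Galton-Watson tree $T$ with offspring distribution $\xi$, where the whole tree $T$ is revealed to both players at the start. Let $p$ be the probability that Breaker wins when Breaker makes the first move, and $\bar p$ the probability that Breaker wins when Maker makes the first move. Then $$p=g(p)+(1-p)\cdot g'(p)\quad\text{and}\quad \bar p=g(p).$$
   Context: The Galton-Watson tree $T$ is the random rooted family tree with root $\mathbf{0}$ in which all individuals have independent numbers of children distributed as $\xi$. In the $(1,1)$ Maker-Breaker game on a rooted locally finite tree, the players move alternately; in each turn a player picks one edge that has been neither fixated nor removed so far: Maker fixates it (it can no longer be removed), Breaker removes it. Breaker wins if at some time the root $\mathbf{0}$ lies in a finite component separated from the rest of the tree by removed edges (in particular Breaker wins if $T$ is finite); otherwise Maker wins (which amounts to fixating an infinite path starting at $\mathbf{0}$). Both players play optimally. When the tree is known to both players the game is deterministic given $T$, and $p$ (resp. $\bar p$) is the probability, with respect to the random tree $T$, that Breaker has a winning strategy when Breaker (resp. Maker) starts. *)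

theory Defs
  imports "HOL-Probability.Probability"
begin

section \<open>The (1,1) Maker-Breaker game on a rooted graph\<close>

text \<open>
  An edge joining \<open>u\<close> and \<open>v\<close> is the set \<open>{u, v}\<close>.  A history is the list of the edges picked so
  far, in chronological order; since the players alternate, the history together with the starting
  player determines which edges were fixated and which were removed.
\<close>

datatype player = Maker | Breaker

fun opponent :: "player \<Rightarrow> player" where
  "opponent Maker = Breaker"
| "opponent Breaker = Maker"

definition mover :: "player \<Rightarrow> nat \<Rightarrow> player" where
  "mover s n = (if even n then s else opponent s)"

type_synonym 'v strategy = "'v set list \<Rightarrow> 'v set"

definition legal_strategy :: "'v set set \<Rightarrow> 'v strategy \<Rightarrow> bool" where
  "legal_strategy E \<sigma> \<longleftrightarrow> (\<forall>h. distinct h \<and> set h \<subset> E \<longrightarrow> \<sigma> h \<in> E - set h)"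

text \<open>
  \<open>play E s \<mu> \<beta> n\<close> is the history after \<open>n\<close> turns if \<open>s\<close> starts, Maker follows \<open>\<mu>\<close> and Breaker
  follows \<open>\<beta>\<close>.  The history stays constant once every edge has been picked, which can only happen
  when \<open>E\<close> is finite.
\<close>

primrec play :: "'v set set \<Rightarrow> player \<Rightarrow> 'v strategy \<Rightarrow> 'v strategy \<Rightarrow> nat \<Rightarrow> 'v set list" where
  "play E s \<mu> \<beta> 0 = []"
| "play E s \<mu> \<beta> (Suc n) =
     (let h = play E s \<mu> \<beta> n in
      if set h = E then h
      else h @ [case mover s (length h) of Maker \<Rightarrow> \<mu> h | Breaker \<Rightarrow> \<beta> h])"

definition removed :: "player \<Rightarrow> 'v set list \<Rightarrow> 'v set set" where
  "removed s h = {h ! i | i. i < length h \<and> mover s i = Breaker}"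

definition component :: "'v set set \<Rightarrow> 'v \<Rightarrow> 'v set" where
  "component E r = {v. (r, v) \<in> {(u, w). {u, w} \<in> E}\<^sup>*}"

text \<open>Breaker, knowing the whole edge set \<open>E\<close>, has a winning strategy when \<open>s\<close> starts.\<close>

definition breaker_wins :: "'v set set \<Rightarrow> 'v \<Rightarrow> player \<Rightarrow> bool" where
  "breaker_wins E r s \<longleftrightarrow>
     (\<exists>\<beta>. legal_strategy E \<beta> \<and>
        (\<forall>\<mu>. legal_strategy E \<mu> \<longrightarrow>
           (\<exists>n. finite (component (E - removed s (play E s \<mu> \<beta> n)) r))))"


section \<open>Galton-Watson trees\<close>

text \<open>
  Ulam-Harris labelling: the root is \<open>[]\<close> and the children of \<open>v\<close> are \<open>v @ [i]\<close> with \<open>i < c v\<close>,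
  where \<open>c v\<close> is the number of children of \<open>v\<close>.  The values of \<open>c\<close> at labels that do not occur in
  the tree are irrelevant.
\<close>

inductive_set family_tree :: "(nat list \<Rightarrow> nat) \<Rightarrow> nat list set" for c where
  root: "[] \<in> family_tree c"
| child: "v \<in> family_tree c \<Longrightarrow> i < c v \<Longrightarrow> v @ [i] \<in> family_tree c"

definition family_tree_edges :: "(nat list \<Rightarrow> nat) \<Rightarrow> nat list set set" where
  "family_tree_edges c = {{v, v @ [i]} | v i. v \<in> family_tree c \<and> i < c v}"

text \<open>
  \<open>X v\<close> is the number of children of the individual labelled \<open>v\<close>, for every potential individual.
\<close>

definition galton_watson :: "'a measure \<Rightarrow> (nat list \<Rightarrow> 'a \<Rightarrow> nat) \<Rightarrow> nat pmf \<Rightarrow> bool" where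
  "galton_watson M X \<xi> \<longleftrightarrow>
     prob_space M \<and>
     prob_space.indep_vars M (\<lambda>_. count_space UNIV) X UNIV \<and>
     (\<forall>v. distr M (count_space UNIV) (X v) = measure_pmf \<xi>)"

definition breaker_event :: "'a measure \<Rightarrow> (nat list \<Rightarrow> 'a \<Rightarrow> nat) \<Rightarrow> player \<Rightarrow> 'a set" where
  "breaker_event M X s =
     {\<omega> \<in> space M. breaker_wins (family_tree_edges (\<lambda>v. X v \<omega>)) [] s}"

text \<open>
  The series converges for \<open>\<bar>x\<bar> \<le> 1\<close> and is differentiable for \<open>\<bar>x\<bar> < 1\<close>.  At \<open>x = 1\<close> the
  derivative need not exist (or be finite); the product \<open>(1 - x) * deriv (pgf \<xi>) x\<close> is \<open>0\<close> there.
\<close>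

definition pgf :: "nat pmf \<Rightarrow> real \<Rightarrow> real" where
  "pgf \<xi> x = (\<Sum>k. pmf \<xi> k * x ^ k)"

end

theory Submission
  imports Defs "HOL-Library.Sublist"
begin

text \<open>
  Breaker wins at a finite time if at all, so the game is open for Breaker and the winning positions
  form an inductive predicate.  Call a branch at the root good if Breaker, moving first, wins on it.
  If Maker moves first and every branch is good, Breaker treats the branches as a sum of games: he
  removes the root edge of a branch that Maker enters through an inner edge, and plays his winning
  strategy in a branch whose root edge Maker fixates.  If Breaker moves first, he can discard one
  bad branch, but not two.  Hence \<open>pbar\<close> is the probability that all branches are good, and \<open>p\<close>
  the probability that at most one is bad.  By local finiteness, Breaker moving first wins iff for
  some \<open>n\<close> the tree contains no binary subtree of height \<open>n\<close> from the root, which makes both events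
  measurable.
\<close>

section \<open>Winning positions\<close>

text \<open>
  In \<open>win fin s A F\<close> the player \<open>s\<close> is to move, \<open>A\<close> is the set of edges not yet removed and \<open>F\<close> the
  set of fixated edges, so that \<open>A - F\<close> is free.  With no free edge left \<open>fixate\<close> holds vacuously; this
  does no harm because then \<open>A\<close> is finite and \<open>fin A\<close> holds.
\<close>

inductive win :: "('e set \<Rightarrow> bool) \<Rightarrow> player \<Rightarrow> 'e set \<Rightarrow> 'e set \<Rightarrow> bool" for fin where
  over: "fin A \<Longrightarrow> win fin Breaker A F"
| remove: "e \<in> A - F \<Longrightarrow> win fin Maker (A - {e}) F \<Longrightarrow> win fin Breaker A F"
| fixate: "(\<And>e. e \<in> A - F \<Longrightarrow> win fin Breaker A (insert e F)) \<Longrightarrow> win fin Maker A F"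

text \<open>No move of Maker changes \<open>A\<close>, so \<open>over\<close> still applies after
  it.\<close>

lemma win_over: "fin A \<Longrightarrow> win fin s A F"
  by (cases s) (auto intro: win.intros)

locale game =
  fixes fin :: "'e set \<Rightarrow> bool"
  assumes fin_subset: "A \<subseteq> B \<Longrightarrow> fin B \<Longrightarrow> fin A"
    and fin_finite: "finite A \<Longrightarrow> fin A"
begin

text \<open>An extra removed edge, a fixated edge made free again and an extra turn never hurt
  Breaker. The extra turn belongs in the same induction: it arises when the edge that Breaker wants
  to remove is already missing from \<open>A'\<close>.\<close>

lemma win_mono:
  assumes "win fin s A F" "finite F" "A' \<subseteq> A" "F' \<subseteq> F"
  shows "win fin Breaker A' F'" and "s = Maker \<Longrightarrow> win fin Maker A' F'"
proof -
  have "win fin Breaker A' F' \<and> (s = Maker \<longrightarrow> win fin Maker A' F')"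
    using assms
  proof (induction arbitrary: A' F')
    case (over A F)
    then show ?case
      using fin_subset[of A' A] by (simp add: win.over)
  next
    case (remove e A F)
    show ?case
    proof (cases "e \<in> A'")
      case True
      then have "win fin Maker (A' - {e}) F'"
        using remove.IH[of "A' - {e}" F'] remove.prems by auto
      then show ?thesis
        using True remove by (auto intro: win.remove[of e])
    next
      case False
      then show ?thesis
        using remove.IH[of A' F'] remove.prems by auto
    qed
  next
    case (fixate A F)
    have B: "win fin Breaker A' F'"
    proof (cases "A - F = {}")
      \<comment> \<open>Without free edges \<open>A\<close> is contained in the finite set
        \<open>F\<close>.\<close>
      case True
      then show ?thesis
        using fixate.prems fin_finite[of A'] by (auto intro: win.over finite_subset)
    next
      case False
      \<comment> \<open>Any Maker move \<open>d\<close> will do: the induction hypothesis for it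
        also covers positions in which \<open>d\<close> is not fixated.\<close>
      then obtain d where "d \<in> A - F" by blast
      then show ?thesis
        using fixate.IH[of d A' F'] fixate.prems by auto
    qed
    have "win fin Breaker A' (insert e F')" if "e \<in> A' - F'" for e
    proof (cases "e \<in> F")
      case True
      show ?thesis
      proof (cases "A - F = {}")
        case True
        then show ?thesis
          using fixate.prems fin_finite[of A'] by (auto intro: win.over finite_subset)
      next
        case False
        then obtain d where "d \<in> A - F" by blast
        then show ?thesis
          using fixate.IH[of d A' "insert e F'"] fixate.prems True by auto
      qed
    next
      case False
      then show ?thesis
        using fixate.IH[of e A' "insert e F'"] fixate.prems that by auto
    qed
    then show ?case
      using B by (auto intro: win.fixate)
  qed
  then show "win fin Breaker A' F'" "s = Maker \<Longrightarrow> win fin Maker A' F'"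
    by auto
qed

section \<open>Sums of games\<close>

text \<open>The summand in \<open>S\<close> is already decided, so a Maker move there is wasted:
  Breaker replies as he would to an arbitrary Maker move in \<open>T\<close>.\<close>

lemma win_union_over:
  assumes un: "\<And>A B. A \<subseteq> S \<Longrightarrow> B \<subseteq> T \<Longrightarrow> fin A \<Longrightarrow> fin B \<Longrightarrow> fin (A \<union> B)"
    and "S \<inter> T = {}"
  assumes "win fin s B G" "finite G" "B \<subseteq> T" "G \<subseteq> T" "finite F" "F \<subseteq> S" "A \<subseteq> S" "fin A"
  shows "win fin s (A \<union> B) (F \<union> G)"
  using assms(3-)
proof (induction arbitrary: F)
  case (over B G)
  then show ?case
    using un[of A B] by (simp add: win.over)
next
  case (remove e B G)
  have "A \<union> B - {e} = A \<union> (B - {e})" "e \<in> (A \<union> B) - (F \<union> G)"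
    using remove.hyps remove.prems \<open>S \<inter> T = {}\<close> by auto
  moreover have "win fin Maker (A \<union> (B - {e})) (F \<union> G)"
    using remove.IH[of F] remove.prems by auto
  ultimately show ?case
    by (simp add: win.remove)
next
  case (fixate B G)
  show ?case
  proof (rule win.fixate)
    fix e assume e: "e \<in> A \<union> B - (F \<union> G)"
    show "win fin Breaker (A \<union> B) (insert e (F \<union> G))"
    proof (cases "e \<in> B")
      case True
      then have "win fin Breaker (A \<union> B) (F \<union> insert e G)"
        using fixate.IH[of e F] fixate.prems e by auto
      then show ?thesis by simp
    next
      case False
      then have F: "finite (insert e F)" "insert e F \<subseteq> S"
        using e fixate.prems by auto
      show ?thesis
      proof (cases "B - G = {}")
        case True
        then have "fin B"
          using fin_finite fixate.prems by (simp add: finite_subset)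
        then show ?thesis
          using un[of A B] fixate.prems by (simp add: win.over)
      next
        case False
        then obtain d where d: "d \<in> B - G" by blast
        then have "win fin Breaker (A \<union> B) (insert e F \<union> insert d G)"
          using fixate.IH[of d "insert e F"] fixate.prems F by auto
        then show ?thesis
          by (rule win_mono(1))
            (use fixate.prems F in auto)
      qed
    qed
  qed
qed

text \<open>Breaker answers in the summand in which Maker has just moved. At most one summand may be
  waiting for Breaker, since he cannot reply in both at once. The induction is nested: on the first
  derivation and, when Maker is to move there, on the second.\<close>

lemma win_union:
  assumes un: "\<And>A B. A \<subseteq> S \<Longrightarrow> B \<subseteq> T \<Longrightarrow> fin A \<Longrightarrow> fin B \<Longrightarrow> fin (A \<union> B)"
    and dj: "S \<inter> T = {}"
  assumes "win fin s A F" "finite F" "A \<subseteq> S" "F \<subseteq> S"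
    and "win fin t B G" "finite G" "B \<subseteq> T" "G \<subseteq> T"
    and "s = Maker \<or> t = Maker"
  shows "win fin (if s = Maker then t else s) (A \<union> B) (F \<union> G)"
  using assms(3-)
proof (induction arbitrary: t B G)
  case (over A F)
  have "win fin Maker (A \<union> B) (F \<union> G)"
    by (rule win_union_over[OF un dj]) (use over in auto)
  then have "win fin Breaker (A \<union> B) (F \<union> G)"
    by (rule win_mono(1)) (use over in auto)
  then show ?case by simp
next
  case (remove e A F)
  have "win fin Maker ((A - {e}) \<union> B) (F \<union> G)"
    using remove.IH[of t B G] remove.prems by auto
  moreover have "A \<union> B - {e} = (A - {e}) \<union> B" "e \<in> (A \<union> B) - (F \<union> G)"
    using remove.hyps remove.prems dj by auto
  ultimately show ?case
    by (simp add: win.remove)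
next
  case (fixate A F)
  \<comment> \<open>The facts about the first summand, its induction hypothesis included, are
    chained in so that the inner induction carries them along as premises.\<close>
  from fixate.prems(4-) fixate.prems(1-3) fixate.hyps fixate.IH show ?case
  proof (induction rule: win.induct)
    case (over B G)
    have w: "win fin Maker A F"
      using over by (blast intro: win.fixate)
    have "win fin Maker (B \<union> A) (G \<union> F)"
    proof (rule win_union_over[OF _ _ w])
      show "T \<inter> S = {}" using dj by blast
      show "fin (A \<union> B)" if "A \<subseteq> T" "B \<subseteq> S" "fin A" "fin B" for A B
        using un[of B A] that by (simp add: Un_commute)
    qed (use over in auto)
    then have "win fin Breaker (A \<union> B) (F \<union> G)"
      by (rule win_mono(1)) (use over in auto)
    then show ?case by simp
  next
    case (remove e B G)
    have "win fin Maker (A \<union> (B - {e})) (F \<union> G)"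
      using remove.IH remove.prems by auto
    moreover have "A \<union> B - {e} = A \<union> (B - {e})" "e \<in> (A \<union> B) - (F \<union> G)"
      using remove.hyps remove.prems dj by auto
    ultimately show ?case
      by (simp add: win.remove)
  next
    case (fixate B G)
    have "win fin Breaker (A \<union> B) (insert e (F \<union> G))" if e: "e \<in> A \<union> B - (F \<union> G)" for e
    proof (cases "e \<in> B")
      case True
      then have "win fin Breaker (A \<union> B) (F \<union> insert e G)"
        using fixate.IH[of e] fixate.prems e by auto
      then show ?thesis by simp
    next
      case False
      then have "e \<in> A - F" using e by blast
      moreover have "win fin Maker B G"
        using fixate.hyps by (blast intro: win.fixate)
      \<comment> \<open>Maker has moved in the first summand; \<open>fixate.prems(9)\<close> is the
        hypothesis of the outer induction.\<close>
      ultimately have "win fin Breaker (A \<union> B) (insert e F \<union> G)"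
        using fixate.prems(9)[of e Maker B G] fixate.prems(1-7) by auto
      then show ?thesis by simp
    qed
    then show ?case
      by (auto intro: win.fixate)
  qed
qed

end

lemma win_image:
  assumes "win fin s A F" "inj_on f S" "A \<subseteq> S" "F \<subseteq> S"
    and "\<And>A. A \<subseteq> S \<Longrightarrow> fin A \<Longrightarrow> fin' (f ` A)"
  shows "win fin' s (f ` A) (f ` F)"
  using assms
proof (induction)
  case (over A F)
  then show ?case by (auto intro: win.over)
next
  case (remove e A F)
  have "f e \<in> f ` A - f ` F" "f ` A - {f e} = f ` (A - {e})"
    using remove.hyps remove.prems by (auto simp: inj_on_def)
  moreover have "win fin' Maker (f ` (A - {e})) (f ` F)"
    using remove.IH remove.prems by blast
  ultimately show ?case
    by (simp add: win.remove[of "f e"])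
next
  case (fixate A F)
  show ?case
  proof (rule win.fixate)
    fix e assume "e \<in> f ` A - f ` F"
    then obtain d where "e = f d" "d \<in> A - F" by blast
    then show "win fin' Breaker (f ` A) (insert e (f ` F))"
      using fixate.IH[of d] fixate.prems by auto
  qed
qed

text \<open>Serves to replace edges given as two-element sets by nodes of the tree. The converse
  direction is \<open>win_image\<close> for the inverse of \<open>f\<close>.\<close>

lemma win_image_iff:
  assumes "inj_on f S" "A \<subseteq> S" "F \<subseteq> S" "\<And>A. A \<subseteq> S \<Longrightarrow> fin' (f ` A) \<longleftrightarrow> fin A"
  shows "win fin' s (f ` A) (f ` F) \<longleftrightarrow> win fin s A F"
proof
  have eq: "inv_into S f ` f ` B = B" if "B \<subseteq> S" for B
    using that assms(1) by (simp add: inv_into_image_cancel)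
  assume "win fin' s (f ` A) (f ` F)"
  then have "win fin s (inv_into S f ` f ` A) (inv_into S f ` f ` F)"
  proof (rule win_image[of _ _ _ _ _ "f ` S"])
    show "inj_on (inv_into S f) (f ` S)"
      by (simp add: inj_on_inv_into)
    show "fin (inv_into S f ` B)" if B: "B \<subseteq> f ` S" "fin' B" for B
    proof -
      obtain C where "C \<subseteq> S" "B = f ` C"
        using B(1) by (meson subset_imageE)
      then show ?thesis
        using B(2) assms(4) eq by simp
    qed
  qed (use assms in auto)
  then show "win fin s A F"
    using eq assms by simp
qed (use win_image[of fin s A F f S fin'] assms in auto)

section \<open>Strategies and winning positions\<close>

text \<open>One turn as a map on histories, so that a play can be resumed from any history and not
  only from \<open>[]\<close>.\<close>

definition turn :: "'v set set \<Rightarrow> player \<Rightarrow> 'v strategy \<Rightarrow> 'v strategy \<Rightarrow> 'v set list \<Rightarrow> 'v set list" where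
  "turn E s \<mu> \<beta> h = (if set h = E then h
      else h @ [case mover s (length h) of Maker \<Rightarrow> \<mu> h | Breaker \<Rightarrow> \<beta> h])"

lemma play_eq_turn: "play E s \<mu> \<beta> n = (turn E s \<mu> \<beta> ^^ n) []"
  by (induction n) (simp_all add: turn_def Let_def)

lemma turn_cong:
  assumes "\<And>w. \<beta> (h @ w) = \<beta>' (h @ w)"
  shows "(turn E s \<mu> \<beta> ^^ n) h = (turn E s \<mu> \<beta>' ^^ n) h"
proof -
  have "(turn E s \<mu> \<beta> ^^ n) h = (turn E s \<mu> \<beta>' ^^ n) h \<and> prefix h ((turn E s \<mu> \<beta>' ^^ n) h)"
  proof (induction n)
    case (Suc n)
    then obtain w where "(turn E s \<mu> \<beta>' ^^ n) h = h @ w"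
      by (auto simp: prefix_def)
    moreover have "turn E s \<mu> \<beta> (h @ w) = turn E s \<mu> \<beta>' (h @ w)"
      by (simp add: turn_def assms split: player.split)
    moreover have "prefix h (turn E s \<mu> \<beta>' (h @ w))"
      by (simp add: turn_def)
    ultimately show ?case
      using Suc by simp
  qed simp
  then show ?thesis ..
qed

lemma legal_strategy_exists: "\<exists>\<beta>. legal_strategy E \<beta>"
proof
  show "legal_strategy E (\<lambda>h. SOME e. e \<in> E - set h)"
    unfolding legal_strategy_def
  proof (intro allI impI)
    fix h assume "distinct h \<and> set h \<subset> E"
    then have "\<exists>e. e \<in> E - set h" by blast
    then show "(SOME e. e \<in> E - set h) \<in> E - set h"
      by (rule someI_ex)
  qed
qed

lemma removed_subset: "removed s h \<subseteq> set h"
  by (auto simp: removed_def)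

lemma in_removed_iff: "x \<in> removed s h \<longleftrightarrow> (\<exists>i<length h. x = h ! i \<and> mover s i = Breaker)"
  by (auto simp: removed_def)

lemma removed_snoc:
  "removed s (h @ [e]) = (if mover s (length h) = Breaker then insert e (removed s h) else removed s h)"
proof -
  have "x \<in> removed s (h @ [e]) \<longleftrightarrow> (mover s (length h) = Breaker \<and> x = e) \<or> x \<in> removed s h" for x
    by (auto simp: in_removed_iff Ex_less_Suc nth_append cong: conj_cong)
  then show ?thesis
    by auto
qed

lemma mover_Suc: "mover s (Suc n) = opponent (mover s n)"
  by (cases s) (auto simp: mover_def)

context
  fixes E :: "'v set set" and r :: 'v and s :: player
begin

definition fixated :: "'v set list \<Rightarrow> 'v set set" where
  "fixated h = set h - removed s h"

abbreviation won :: "'v set set \<Rightarrow> bool" where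
  "won A \<equiv> finite (component A r)"

abbreviation winning :: "'v set list \<Rightarrow> bool" where
  "winning h \<equiv> win won (mover s (length h)) (E - removed s h) (fixated h)"

lemma winning_snoc_Breaker:
  assumes "mover s (length h) = Breaker" "e \<in> E - set h"
  shows "winning (h @ [e]) \<longleftrightarrow> win won Maker (E - removed s h - {e}) (fixated h)"
proof -
  have "fixated (h @ [e]) = fixated h"
    using assms removed_subset[of s h] by (auto simp: fixated_def removed_snoc)
  moreover have "E - removed s (h @ [e]) = E - removed s h - {e}"
    using assms by (auto simp: removed_snoc)
  ultimately show ?thesis
    using assms by (simp add: mover_Suc)
qed

lemma winning_snoc_Maker:
  assumes "mover s (length h) = Maker" "e \<in> E - set h"
  shows "winning (h @ [e]) \<longleftrightarrow> win won Breaker (E - removed s h) (insert e (fixated h))"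
proof -
  have "fixated (h @ [e]) = insert e (fixated h)"
    using assms removed_subset[of s h] by (auto simp: fixated_def removed_snoc)
  then show ?thesis
    using assms by (simp add: mover_Suc removed_snoc)
qed

lemma free_edges: "E - removed s h - fixated h = E - set h"
  using removed_subset[of s h] by (auto simp: fixated_def)

definition forces :: "'v strategy \<Rightarrow> 'v set list \<Rightarrow> bool" where
  "forces \<beta> h \<longleftrightarrow> (\<forall>\<mu>. legal_strategy E \<mu> \<longrightarrow>
     (\<exists>n. won (E - removed s ((turn E s \<mu> \<beta> ^^ n) h))))"

lemma breaker_wins_iff_forces: "breaker_wins E r s \<longleftrightarrow> (\<exists>\<beta>. legal_strategy E \<beta> \<and> forces \<beta> [])"
  by (simp add: breaker_wins_def forces_def play_eq_turn)

lemma forces_cong: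
  assumes "\<And>w. \<beta> (h @ w) = \<beta>' (h @ w)" "forces \<beta> h"
  shows "forces \<beta>' h"
  using assms(2) unfolding forces_def turn_cong[of \<beta> h \<beta>', OF assms(1)] .

lemma forces_step:
  assumes "set h \<noteq> E" "\<And>\<mu>. legal_strategy E \<mu> \<Longrightarrow> forces \<beta> (turn E s \<mu> \<beta> h)"
  shows "forces \<beta> h"
  unfolding forces_def
proof (intro allI impI)
  fix \<mu> assume \<mu>: "legal_strategy E \<mu>"
  with assms(2) obtain n where "won (E - removed s ((turn E s \<mu> \<beta> ^^ n) (turn E s \<mu> \<beta> h)))"
    unfolding forces_def by blast
  then show "\<exists>n. won (E - removed s ((turn E s \<mu> \<beta> ^^ n) h))"
    by (intro exI[of _ "Suc n"]) (simp add: funpow_swap1)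
qed

text \<open>A derivation of \<open>win\<close> is a strategy tree for Breaker; the induction turns
  it into a strategy that works from the history \<open>h\<close> on.\<close>

lemma winning_imp_forces:
  assumes won_finite: "\<And>A. finite A \<Longrightarrow> won A"
    and "win won pl A F" "distinct h" "set h \<subseteq> E"
    "pl = mover s (length h)" "A = E - removed s h" "F = fixated h"
  shows "\<exists>\<beta>. legal_strategy E \<beta> \<and> forces \<beta> h"
  using assms(2-)
proof (induction arbitrary: h)
  case (over A F)
  then have "forces \<beta> h" for \<beta>
    unfolding forces_def by (metis funpow_0)
  then show ?case
    using legal_strategy_exists by blast
next
  case (remove e A F)
  have e: "e \<in> E - set h"
    using remove.hyps(1) free_edges[of h] by (simp add: remove.prems)
  have mv: "mover s (length h) = Breaker"
    using remove.prems by simp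
  have "\<exists>\<beta>. legal_strategy E \<beta> \<and> forces \<beta> (h @ [e])"
  proof (rule remove.IH)
    show "distinct (h @ [e])" "set (h @ [e]) \<subseteq> E" "Maker = mover s (length (h @ [e]))"
      using remove.prems(1,2) e mv by (auto simp: mover_Suc)
    show "A - {e} = E - removed s (h @ [e])" "F = fixated (h @ [e])"
      using e mv remove.prems removed_subset[of s h] by (auto simp: fixated_def removed_snoc)
  qed
  then obtain \<beta> where \<beta>: "legal_strategy E \<beta>" "forces \<beta> (h @ [e])" by blast
  \<comment> \<open>Only the reply at \<open>h\<close> itself changes; no history extending
    \<open>h @ [e]\<close> is affected.\<close>
  define \<beta>' where "\<beta>' = \<beta>(h := e)"
  have "forces \<beta>' (h @ [e])"
    by (rule forces_cong[OF _ \<beta>(2)]) (simp add: \<beta>'_def)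
  moreover have "turn E s \<mu> \<beta>' h = h @ [e]" for \<mu>
    using e mv by (auto simp: turn_def \<beta>'_def)
  moreover have "set h \<noteq> E"
    using e by blast
  ultimately have "forces \<beta>' h"
    by (intro forces_step[of h \<beta>']) simp_all
  moreover have "legal_strategy E \<beta>'"
    using \<beta>(1) e by (simp add: legal_strategy_def \<beta>'_def)
  ultimately show ?case by blast
next
  case (fixate A F)
  have mv: "mover s (length h) = Maker"
    using fixate.prems by simp
  have "\<exists>\<beta>. legal_strategy E \<beta> \<and> forces \<beta> (h @ [e])" if e: "e \<in> E - set h" for e
  proof (rule fixate.IH)
    show "e \<in> A - F"
      using e free_edges[of h] fixate.prems by simp
    show "distinct (h @ [e])" "set (h @ [e]) \<subseteq> E" "Breaker = mover s (length (h @ [e]))"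
      using fixate.prems(1,2) e mv by (auto simp: mover_Suc)
    show "A = E - removed s (h @ [e])" "insert e F = fixated (h @ [e])"
      using e mv fixate.prems removed_subset[of s h] by (auto simp: fixated_def removed_snoc)
  qed
  then obtain b where b: "\<And>e. e \<in> E - set h \<Longrightarrow> legal_strategy E (b e)"
    "\<And>e. e \<in> E - set h \<Longrightarrow> forces (b e) (h @ [e])"
    by metis
  obtain \<beta>0 where \<beta>0: "legal_strategy E \<beta>0"
    using legal_strategy_exists by blast
  \<comment> \<open>The entry at position \<open>length h\<close> is Maker's move at
    \<open>h\<close>; it selects the strategy to follow from there on. \<open>\<beta>0\<close>
    supplies legal moves for the remaining histories.\<close>
  define \<beta> where "\<beta> g = (let e = g ! length h in
    if length h < length g \<and> e \<in> E - set h then b e g else \<beta>0 g)" for g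
  have legal: "legal_strategy E \<beta>"
    using b(1) \<beta>0 by (simp add: legal_strategy_def \<beta>_def Let_def)
  show ?case
  proof (cases "set h = E")
    case True
    then have "won (E - removed s h)"
      by (metis List.finite_set finite_Diff won_finite)
    then have "forces \<beta> h"
      unfolding forces_def by (metis funpow_0)
    then show ?thesis
      using legal by blast
  next
    case False
    have "forces \<beta> h"
    proof (rule forces_step[OF False])
      fix \<mu> assume "legal_strategy E \<mu>"
      then have e: "\<mu> h \<in> E - set h"
        using False fixate.prems(1,2) by (auto simp: legal_strategy_def)
      have "forces \<beta> (h @ [\<mu> h])"
        by (rule forces_cong[OF _ b(2)[OF e]]) (use e in \<open>simp add: \<beta>_def nth_append Let_def\<close>)
      then show "forces \<beta> (turn E s \<mu> \<beta> h)"
        using False mv by (simp add: turn_def)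
    qed
    then show ?thesis
      using legal by blast
  qed
qed

text \<open>Contraposition: from a position that is not winning Maker can move to another such
  position, and no removal by Breaker leads out of them. In all of them the component of the root is
  infinite, so Maker defeats any strategy of Breaker by staying there.\<close>

lemma forces_imp_winning:
  assumes won_finite: "\<And>A. finite A \<Longrightarrow> won A"
    and \<beta>: "legal_strategy E \<beta>" "forces \<beta> []"
  shows "winning []"
proof (rule ccontr)
  assume not: "\<not> winning []"
  define good where "good h e \<longleftrightarrow> e \<in> E - set h \<and> \<not> winning (h @ [e])" for h e
  \<comment> \<open>The second branch takes any free edge, to keep the strategy legal at every
    history.\<close>
  define \<mu> where "\<mu> h = (if \<exists>e. good h e then SOME e. good h e else SOME e. e \<in> E - set h)" for h
  have good: "good h (\<mu> h)" if "\<exists>e. good h e" for h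
    using that someI_ex[of "good h"] by (simp add: \<mu>_def)
  have \<mu>: "legal_strategy E \<mu>"
    unfolding legal_strategy_def
  proof (intro allI impI)
    fix h assume "distinct h \<and> set h \<subset> E"
    then have *: "\<exists>e. e \<in> E - set h" by blast
    show "\<mu> h \<in> E - set h"
    proof (cases "\<exists>e. good h e")
      case True
      then show ?thesis
        using good by (auto simp: good_def)
    next
      case False
      then have "\<mu> h = (SOME e. e \<in> E - set h)"
        by (auto simp: \<mu>_def)
      then show ?thesis
        using someI_ex[OF *] by simp
    qed
  qed
  define safe where "safe h \<longleftrightarrow> distinct h \<and> set h \<subseteq> E \<and> \<not> winning h" for h
  have step: "safe (turn E s \<mu> \<beta> h)" if "safe h" for h
  proof -
    have h: "distinct h" "set h \<subseteq> E" "\<not> winning h"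
      using that by (simp_all add: safe_def)
    have "set h \<noteq> E"
    proof
      assume "set h = E"
      then have "won (E - removed s h)"
        by (metis List.finite_set finite_Diff won_finite)
      then show False
        using h(3) by (blast intro: win_over)
    qed
    then have sub: "distinct h \<and> set h \<subset> E"
      using h by blast
    show ?thesis
    proof (cases "mover s (length h)")
      case Maker
      have "\<exists>e. good h e"
      proof (rule ccontr)
        assume "\<nexists>e. good h e"
        then have "win won Breaker (E - removed s h) (insert e (fixated h))" if "e \<in> E - set h" for e
          using winning_snoc_Maker[OF Maker that] that by (auto simp: good_def)
        then have "winning h"
          unfolding Maker by (intro win.fixate) (simp add: free_edges)
        with h(3) show False ..
      qed
      then have "good h (\<mu> h)" by (rule good)
      then show ?thesis
        using sub \<open>set h \<noteq> E\<close> Maker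
        by (auto simp: turn_def good_def safe_def)
    next
      case Breaker
      have e: "\<beta> h \<in> E - set h"
        using \<beta>(1) sub by (simp add: legal_strategy_def)
      have "\<not> winning (h @ [\<beta> h])"
      proof
        assume "winning (h @ [\<beta> h])"
        then have "win won Breaker (E - removed s h) (fixated h)"
          using winning_snoc_Breaker[OF Breaker e] e
          by (intro win.remove[of "\<beta> h"]) (simp_all add: free_edges)
        then show False
          using h(3) Breaker by simp
      qed
      then show ?thesis
        using sub \<open>set h \<noteq> E\<close> Breaker e
        by (auto simp: turn_def safe_def)
    qed
  qed
  have "safe ((turn E s \<mu> \<beta> ^^ n) [])" for n
    by (induction n) (use not step in \<open>simp_all add: safe_def\<close>)
  then have "\<not> won (E - removed s ((turn E s \<mu> \<beta> ^^ n) []))" for n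
    unfolding safe_def using win_over[of won] by metis
  then show False
    using \<beta>(2) \<mu> by (auto simp: forces_def)
qed

lemma breaker_wins_iff_win:
  assumes "\<And>A. finite A \<Longrightarrow> won A"
  shows "breaker_wins E r s \<longleftrightarrow> win won s E {}"
proof -
  have "removed s [] = {}" "fixated [] = {}" "mover s 0 = s"
    by (auto simp: removed_def fixated_def mover_def)
  then show ?thesis
    unfolding breaker_wins_iff_forces
    using winning_imp_forces[OF assms, of s E "{}" "[]"] forces_imp_winning[OF assms]
    by auto
qed

end

text \<open>\<open>E\<close> may contain infinite sets, but every step follows a set of at most two
  vertices; hence the restriction to finite members of \<open>E\<close> in the bound.\<close>

lemma finite_component:
  assumes "finite E"
  shows "finite (component E r)"
proof -
  have "(r, v) \<in> {(u, w). {u, w} \<in> E}\<^sup>* \<Longrightarrow> v \<in> insert r (\<Union>{e \<in> E. finite e})" for v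
    by (induction rule: rtrancl_induct) (auto intro!: bexI)
  then have "component E r \<subseteq> insert r (\<Union>{e \<in> E. finite e})"
    unfolding component_def by blast
  then show ?thesis
    by (rule finite_subset) (use assms in auto)
qed

section \<open>The game on a tree\<close>

text \<open>From here on a node other than \<open>[]\<close> stands for the edge to its parent. Read
  so, \<open>A\<close> is a set of edges and this is the component of the root.\<close>

definition cluster :: "nat list set \<Rightarrow> nat list set" where
  "cluster A = {v. \<forall>u. u \<noteq> [] \<longrightarrow> prefix u v \<longrightarrow> u \<in> A}"

text \<open>Re-rooting at \<open>v\<close>; the edge above \<open>v\<close> itself drops
  out.\<close>

definition subtree :: "nat list \<Rightarrow> nat list set \<Rightarrow> nat list set" where
  "subtree v A = {u. u \<noteq> [] \<and> v @ u \<in> A}"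

abbreviation cut_off :: "nat list set \<Rightarrow> bool" where
  "cut_off A \<equiv> finite (cluster A)"

lemma Nil_in_cluster [simp]: "[] \<in> cluster A"
  by (simp add: cluster_def)

lemma cluster_mono: "A \<subseteq> B \<Longrightarrow> cluster A \<subseteq> cluster B"
  by (auto simp: cluster_def)

lemma cluster_snoc [simp]: "v @ [i] \<in> cluster A \<longleftrightarrow> v \<in> cluster A \<and> v @ [i] \<in> A"
  by (auto simp: cluster_def)

lemma cluster_Cons [simp]: "i # v \<in> cluster A \<longleftrightarrow> [i] \<in> A \<and> v \<in> cluster (subtree [i] A)"
  unfolding cluster_def subtree_def prefix_Cons mem_Collect_eq append_Cons append_Nil
  by (metis list.distinct(1) list.inject prefix_bot.extremum)

lemma cluster_append: "v @ w \<in> cluster A \<longleftrightarrow> v \<in> cluster A \<and> w \<in> cluster (subtree v A)"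
proof (induction w rule: rev_induct)
  case (snoc i w)
  have "v @ w @ [i] \<in> cluster A \<longleftrightarrow> v @ w \<in> cluster A \<and> v @ w @ [i] \<in> A"
    using cluster_snoc[of "v @ w" i A] by simp
  then show ?case
    using snoc by (auto simp: subtree_def)
qed simp

lemma cluster_subset: "cluster A \<subseteq> insert [] A"
  by (auto simp: cluster_def)

lemma subtree_subtree: "subtree v (subtree w A) = subtree (w @ v) A"
  by (auto simp: subtree_def)

lemma Nil_notin_subtree [simp]: "[] \<notin> subtree v A"
  by (simp add: subtree_def)

lemma singleton_in_subtree [simp]: "[i] \<in> subtree v A \<longleftrightarrow> v @ [i] \<in> A"
  by (simp add: subtree_def)

interpretation tree_game: game cut_off
proof
  show "cut_off A" if "A \<subseteq> B" "cut_off B" for A B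
    using cluster_mono[OF that(1)] that(2) by (rule finite_subset)
  show "cut_off A" if "finite A" for A
    using cluster_subset[of A] that by (simp add: finite_subset)
qed

lemma cut_off_subtree:
  assumes "cut_off A" "v \<in> cluster A"
  shows "cut_off (subtree v A)"
proof -
  have "(@) v ` cluster (subtree v A) \<subseteq> cluster A"
    using assms(2) by (auto simp: cluster_append)
  then have "finite ((@) v ` cluster (subtree v A))"
    using assms(1) by (rule finite_subset)
  then show ?thesis
    by (rule finite_imageD) (simp add: inj_on_def)
qed

text \<open>A path from the root stays in the branch that it enters with its first edge, so it uses
  edges of one summand only.\<close>

lemma cut_off_Un:
  assumes "A \<subseteq> {v. v \<noteq> [] \<and> hd v \<in> I}" "B \<subseteq> {v. v \<noteq> [] \<and> hd v \<in> J}" "I \<inter> J = {}"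
    "cut_off A" "cut_off B"
  shows "cut_off (A \<union> B)"
proof -
  have "v \<in> cluster A \<union> cluster B" if "v \<in> cluster (A \<union> B)" for v
  proof (cases v)
    case (Cons i w)
    then have "i \<in> I \<or> i \<in> J"
      using that assms(1,2) by auto
    then show ?thesis
    proof
      assume "i \<in> I"
      then have "u \<notin> B" if "u \<noteq> []" "prefix u v" for u
        using that Cons assms(2,3) by (cases u) (auto dest!: subsetD)
      then show ?thesis
        using that by (auto simp: cluster_def)
    next
      assume "i \<in> J"
      then have "u \<notin> A" if "u \<noteq> []" "prefix u v" for u
        using that Cons assms(1,3) by (cases u) (auto dest!: subsetD)
      then show ?thesis
        using that by (auto simp: cluster_def)
    qed
  qed simp
  then show ?thesis
    using assms(4,5) by (meson finite_UnI finite_subset subsetI)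
qed

lemma cut_off_branch: "[i] \<notin> A \<Longrightarrow> A \<subseteq> {v. v \<noteq> [] \<and> hd v = i} \<Longrightarrow> cut_off A"
proof -
  assume *: "[i] \<notin> A" "A \<subseteq> {v. v \<noteq> [] \<and> hd v = i}"
  have "v = []" if "v \<in> cluster A" for v
    using that * by (cases v) auto
  then show "cut_off A"
    by (metis finite.simps finite_subset insertI1 subsetI)
qed

text \<open>Hanging a tree on a fixated edge adds only one vertex to the component of the root, so
  the moves that win inside the tree still win.\<close>

lemma win_Cons:
  assumes "win cut_off s A F" "[] \<notin> A"
  shows "win cut_off s (insert [i] ((#) i ` A)) (insert [i] ((#) i ` F))"
  using assms
proof (induction)
  case (over A F)
  have "cluster (insert [i] ((#) i ` A)) \<subseteq> insert [] ((#) i ` cluster A)"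
  proof
    fix v assume v: "v \<in> cluster (insert [i] ((#) i ` A))"
    have "subtree [i] (insert [i] ((#) i ` A)) = A"
      using over by (auto simp: subtree_def)
    with v show "v \<in> insert [] ((#) i ` cluster A)"
      by (cases v) auto
  qed
  then have "cut_off (insert [i] ((#) i ` A))"
    by (rule finite_subset) (use over in auto)
  then show ?case by (rule win.over)
next
  case (remove e A F)
  have "insert [i] ((#) i ` A) - {i # e} = insert [i] ((#) i ` (A - {e}))"
    using remove.hyps remove.prems by auto
  then show ?case
    using remove by (intro win.remove[of "i # e"]) auto
next
  case (fixate A F)
  show ?case
  proof (rule win.fixate)
    fix e assume "e \<in> insert [i] ((#) i ` A) - insert [i] ((#) i ` F)"
    then obtain d where d: "e = i # d" "d \<in> A - F" by auto
    have "insert e (insert [i] ((#) i ` F)) = insert [i] ((#) i ` insert d F)"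
      using d by auto
    then show "win cut_off Breaker (insert [i] ((#) i ` A)) (insert e (insert [i] ((#) i ` F)))"
      using fixate.IH[OF d(2)] fixate.prems by simp
  qed
qed

text \<open>If Maker opens with \<open>[i]\<close>, Breaker is first to move in the subtree; any
  other opening is answered by removing \<open>[i]\<close>, which detaches the branch.\<close>

lemma win_Maker_branch:
  assumes "[i] \<in> A \<Longrightarrow> win cut_off Breaker (subtree [i] A) {}" "A \<subseteq> {v. v \<noteq> [] \<and> hd v = i}"
  shows "win cut_off Maker A {}"
proof (cases "[i] \<in> A")
  case False
  then show ?thesis
    using cut_off_branch assms by (blast intro: win_over)
next
  case True
  show ?thesis
  proof (rule win.fixate)
    fix e assume "e \<in> A - {}"
    show "win cut_off Breaker A {e}"
    proof (cases "e = [i]")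
      case e: True
      have "insert [i] ((#) i ` subtree [i] A) = A"
      proof
        show "A \<subseteq> insert [i] ((#) i ` subtree [i] A)"
        proof
          fix v assume "v \<in> A"
          then show "v \<in> insert [i] ((#) i ` subtree [i] A)"
            using assms(2) by (cases v) (force simp: subtree_def)+
        qed
      qed (use True in \<open>auto simp: subtree_def\<close>)
      then show ?thesis
        using win_Cons[OF assms(1)[OF True] Nil_notin_subtree, of i] e by simp
    next
      case False
      have "cut_off (A - {[i]})"
        by (rule cut_off_branch) (use assms in auto)
      then show ?thesis
        using True False by (intro win.remove[of "[i]"]) (auto intro: win_over)
    qed
  qed
qed

lemma win_Maker_Un:
  assumes "win cut_off Maker A {}" "win cut_off Maker B {}"
    "A \<subseteq> {v. v \<noteq> [] \<and> hd v \<in> I}" "B \<subseteq> {v. v \<noteq> [] \<and> hd v \<in> J}" "I \<inter> J = {}"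
  shows "win cut_off Maker (A \<union> B) {}"
proof -
  have "win cut_off (if Maker = Maker then Maker else Maker) (A \<union> B) ({} \<union> {})"
  proof (rule tree_game.win_union[OF _ _ assms(1) _ assms(3) _ assms(2) _ assms(4)])
    show "{v. v \<noteq> [] \<and> hd v \<in> I} \<inter> {v. v \<noteq> [] \<and> hd v \<in> J} = {}"
      using assms(5) by auto
    show "cut_off (A \<union> B)" if "A \<subseteq> {v. v \<noteq> [] \<and> hd v \<in> I}" "B \<subseteq> {v. v \<noteq> [] \<and> hd v \<in> J}"
      "cut_off A" "cut_off B" for A B
      using cut_off_Un that assms(5) by blast
  qed auto
  then show ?thesis by simp
qed

text \<open>The branches attached to the root are finitely many and are added up one by one. The
  detached ones form a single further summand, whose cluster is \<open>{[]}\<close>.\<close>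

lemma win_MakerI:
  assumes fin: "finite {i. [i] \<in> A}" and "[] \<notin> A"
    and win: "\<And>i. [i] \<in> A \<Longrightarrow> win cut_off Breaker (subtree [i] A) {}"
  shows "win cut_off Maker A {}"
proof -
  define br where "br I = {v \<in> A. hd v \<in> I}" for I
  have sub: "br I \<subseteq> {v. v \<noteq> [] \<and> hd v \<in> I}" for I
    using assms(2) by (auto simp: br_def)
  have "win cut_off Maker (br I) {}" if "finite I" for I
    using that
  proof induction
    case empty
    then show ?case
      by (auto simp: br_def intro!: win_over tree_game.fin_finite)
  next
    case (insert i I)
    have "win cut_off Maker (br {i}) {}"
    proof (rule win_Maker_branch)
      have "subtree [i] (br {i}) = subtree [i] A"
        by (auto simp: br_def subtree_def)
      then show "win cut_off Breaker (subtree [i] (br {i})) {}" if "[i] \<in> br {i}"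
        using win[of i] that by (auto simp: br_def)
    qed (use sub[of "{i}"] in auto)
    then have "win cut_off Maker (br {i} \<union> br I) {}"
      by (rule win_Maker_Un[OF _ insert.IH sub sub]) (use insert in auto)
    moreover have "br {i} \<union> br I = br (insert i I)"
      by (auto simp: br_def)
    ultimately show ?case by simp
  qed
  then have 1: "win cut_off Maker (br {i. [i] \<in> A}) {}"
    using fin by simp
  have "v = []" if "v \<in> cluster (br {i. [i] \<notin> A})" for v
    using that by (cases v) (auto simp: br_def)
  then have "cluster (br {i. [i] \<notin> A}) \<subseteq> {[]}"
    by auto
  then have 2: "win cut_off Maker (br {i. [i] \<notin> A}) {}"
    by (auto intro: win_over finite_subset)
  have "A = br {i. [i] \<in> A} \<union> br {i. [i] \<notin> A}"
    by (auto simp: br_def)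
  then show ?thesis
    using win_Maker_Un[OF 1 2 sub sub] by auto
qed

section \<open>Binary subtrees and winning positions\<close>

text \<open>\<open>thin n A\<close>: no binary tree of height \<open>n\<close> with root \<open>[]\<close> has all its other nodes in \<open>A\<close>.\<close>

primrec thin :: "nat \<Rightarrow> nat list set \<Rightarrow> bool" where
  "thin 0 A = False"
| "thin (Suc n) A = (\<exists>j. \<forall>i. [i] \<in> A \<longrightarrow> i \<noteq> j \<longrightarrow> thin n (subtree [i] A))"

lemma thin_mono: "thin n A \<Longrightarrow> n \<le> m \<Longrightarrow> thin m A"
proof (induction n arbitrary: m A)
  case (Suc n)
  from Suc.prems(2) obtain k where "m = Suc k" "n \<le> k"
    by (cases m) auto
  with Suc show ?case
    by auto
qed simp

definition locally_finite :: "nat list set \<Rightarrow> bool" where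
  "locally_finite A \<longleftrightarrow> (\<forall>v. finite {i. v @ [i] \<in> A})"

lemma locally_finite_subtree: "locally_finite A \<Longrightarrow> locally_finite (subtree v A)"
  by (simp add: locally_finite_def subtree_def flip: append_assoc)

lemma locally_finite_subset: "locally_finite B \<Longrightarrow> A \<subseteq> B \<Longrightarrow> locally_finite A"
  unfolding locally_finite_def by (metis (mono_tags, lifting) Collect_mono finite_subset subsetD)

text \<open>Breaker spends his first move on the root edge of the branch exempted by
  \<open>thin\<close>; the others are won by him as first mover, so \<open>win_MakerI\<close>
  applies.\<close>

lemma thin_imp_win:
  "thin n A \<Longrightarrow> locally_finite A \<Longrightarrow> [] \<notin> A \<Longrightarrow> win cut_off Breaker A {}"
proof (induction n arbitrary: A)
  case (Suc n)
  then obtain j where j: "\<And>i. [i] \<in> A \<Longrightarrow> i \<noteq> j \<Longrightarrow> thin n (subtree [i] A)"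
    by auto
  have "subtree [i] (A - {[j]}) = subtree [i] A" for i
    by (auto simp: subtree_def)
  then have w: "win cut_off Maker (A - {[j]}) {}"
    using Suc j locally_finite_subset[of A "A - {[j]}"]
    by (intro win_MakerI) (auto simp: locally_finite_subtree locally_finite_def[of "A - _"] dest: spec[of _ "[]"])
  show ?case
  proof (cases "[j] \<in> A")
    case True
    then show ?thesis
      using w by (intro win.remove) auto
  next
    \<comment> \<open>There is no branch to discard, and Breaker's turn is a bonus that
      \<open>win_mono\<close> absorbs.\<close>
    case False
    then show ?thesis
      using tree_game.win_mono(1)[OF w, of A "{}"] by simp
  qed
qed simp

lemma not_thin_imp_long: "\<not> thin n A \<Longrightarrow> \<exists>v \<in> cluster A. length v = n"
proof (induction n arbitrary: A)
  case (Suc n)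
  then obtain i where "[i] \<in> A" "\<not> thin n (subtree [i] A)"
    by auto
  with Suc.IH obtain v where "v \<in> cluster (subtree [i] A)" "length v = n"
    by blast
  then show ?case
    using \<open>[i] \<in> A\<close> by (intro bexI[of _ "i # v"]) auto
qed (auto intro: bexI[of _ "[]"])

lemma cut_off_imp_thin:
  assumes "cut_off A"
  shows "\<exists>n. thin n A"
proof -
  obtain n where "\<forall>v \<in> cluster A. length v < n"
    using assms by (metis finite_imageI finite_nat_set_iff_bounded imageI)
  then show ?thesis
    using not_thin_imp_long by (metis less_irrefl)
qed

text \<open>Finiteness at the root turns the separate heights of the branches into a common one,
  their maximum.\<close>

lemma thin_SucI:
  assumes "finite {i. [i] \<in> A}" "\<And>i. [i] \<in> A \<Longrightarrow> i \<noteq> j \<Longrightarrow> \<exists>n. thin n (subtree [i] A)"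
  shows "\<exists>n. thin n A"
proof -
  obtain N where N: "\<And>i. [i] \<in> A \<Longrightarrow> i \<noteq> j \<Longrightarrow> thin (N i) (subtree [i] A)"
    using assms(2) by metis
  have "thin (Max (N ` {i. [i] \<in> A})) (subtree [i] A)" if "[i] \<in> A" "i \<noteq> j" for i
    using thin_mono[OF N[OF that]] that assms(1) by auto
  then have "thin (Suc (Max (N ` {i. [i] \<in> A}))) A"
    by auto
  then show ?thesis ..
qed

text \<open>The converse of \<open>thin_imp_win\<close>. The induction needs it at every node
  \<open>v\<close> that fixated edges join to the root, since a move of Maker may join one
  more.\<close>

lemma win_imp_thin:
  assumes "win cut_off s A F" "finite F" "locally_finite A" "v \<in> cluster (A \<inter> F)"
  shows "case s of Breaker \<Rightarrow> \<exists>n. thin n (subtree v A)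
    | Maker \<Rightarrow> \<forall>i. v @ [i] \<in> A \<longrightarrow> (\<exists>n. thin n (subtree (v @ [i]) A))"
  using assms
proof (induction arbitrary: v)
  case (over A F)
  then show ?case
    using cut_off_imp_thin cut_off_subtree cluster_mono[of "A \<inter> F" A] by auto
next
  case (remove e A F)
  have "v \<in> cluster ((A - {e}) \<inter> F)"
    using remove.hyps remove.prems(3) cluster_mono[of "A \<inter> F" "(A - {e}) \<inter> F"] by auto
  then have IH: "\<exists>n. thin n (subtree (v @ [i]) (A - {e}))" if "v @ [i] \<in> A - {e}" for i
    using remove.IH[of v] remove.prems(1,2) locally_finite_subset[of A "A - {e}"] that by auto
  \<comment> \<open>The edge \<open>e\<close> lies in the branch of at most one child of
    \<open>v\<close>, which is this one. If \<open>e\<close> is too short for such an entry, the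
    unspecified value does no harm, for then no branch at \<open>v\<close> is affected.\<close>
  define j where "j = e ! length v"
  have "\<exists>n. thin n (subtree v A)"
  proof (rule thin_SucI)
    show "finite {i. [i] \<in> subtree v A}"
      using remove.prems by (simp add: locally_finite_def)
    fix i assume i: "[i] \<in> subtree v A" "i \<noteq> j"
    then have "subtree (v @ [i]) (A - {e}) = subtree (v @ [i]) A" "v @ [i] \<in> A - {e}"
      by (auto simp: subtree_def j_def)
    then show "\<exists>n. thin n (subtree [i] (subtree v A))"
      using IH[of i] by (simp add: subtree_subtree)
  qed
  then show ?case by simp
next
  case (fixate A F)
  have "\<exists>n. thin n (subtree (v @ [i]) A)" if i: "v @ [i] \<in> A" for i
  \<comment> \<open>If \<open>v @ [i]\<close> is free, Maker fixates it; if it is fixated already,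
    any free edge serves as his move. If there is none, \<open>A\<close> is finite.\<close>
  proof (cases "v @ [i] \<in> F \<and> A - F = {}")
    case True
    then have "cut_off A"
      using fixate.prems by (metis Diff_eq_empty_iff tree_game.fin_finite finite_subset)
    moreover have "v @ [i] \<in> cluster A"
      using i fixate.prems(3) cluster_mono[of "A \<inter> F" A] by auto
    ultimately show ?thesis
      using cut_off_imp_thin cut_off_subtree by blast
  next
    case False
    then obtain d where d: "d \<in> A - F" "v @ [i] \<in> insert d F"
      using i by (cases "v @ [i] \<in> F") auto
    then have "v @ [i] \<in> cluster (A \<inter> insert d F)"
      using i fixate.prems(3) cluster_mono[of "A \<inter> F" "A \<inter> insert d F"] by auto
    then show ?thesis
      using fixate.IH[OF d(1), of "v @ [i]"] fixate.prems by auto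
  qed
  then show ?case by simp
qed

lemma win_Breaker_iff:
  assumes "locally_finite A" "[] \<notin> A"
  shows "win cut_off Breaker A {} \<longleftrightarrow> (\<exists>n. thin n A)"
proof
  have "subtree [] A = A"
    using assms(2) by (auto simp: subtree_def)
  then show "\<exists>n. thin n A" if "win cut_off Breaker A {}"
    using win_imp_thin[OF that, of "[]"] assms by simp
qed (use thin_imp_win assms in blast)

lemma win_Maker_iff:
  assumes "locally_finite A" "[] \<notin> A"
  shows "win cut_off Maker A {} \<longleftrightarrow> (\<forall>i. [i] \<in> A \<longrightarrow> (\<exists>n. thin n (subtree [i] A)))"
proof
  show "\<forall>i. [i] \<in> A \<longrightarrow> (\<exists>n. thin n (subtree [i] A))" if "win cut_off Maker A {}"
    using win_imp_thin[OF that, of "[]"] assms by simp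
next
  assume "\<forall>i. [i] \<in> A \<longrightarrow> (\<exists>n. thin n (subtree [i] A))"
  then show "win cut_off Maker A {}"
    using assms by (intro win_MakerI)
      (auto simp: win_Breaker_iff locally_finite_subtree locally_finite_def[of A] dest: spec[of _ "[]"])
qed

text \<open>Dropping the height from both sides gives the recursion over the branches that the
  probabilities will follow.\<close>

lemma thin_iff:
  assumes "locally_finite A"
  shows "(\<exists>n. thin n A) \<longleftrightarrow> (\<exists>j. \<forall>i. [i] \<in> A \<longrightarrow> i \<noteq> j \<longrightarrow> (\<exists>n. thin n (subtree [i] A)))"
proof
  assume "\<exists>n. thin n A"
  then obtain n where "thin n A" ..
  then show "\<exists>j. \<forall>i. [i] \<in> A \<longrightarrow> i \<noteq> j \<longrightarrow> (\<exists>n. thin n (subtree [i] A))"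
    by (cases n) auto
next
  assume "\<exists>j. \<forall>i. [i] \<in> A \<longrightarrow> i \<noteq> j \<longrightarrow> (\<exists>n. thin n (subtree [i] A))"
  then obtain j where "\<And>i. [i] \<in> A \<Longrightarrow> i \<noteq> j \<Longrightarrow> \<exists>n. thin n (subtree [i] A)"
    by blast
  moreover have "finite {i. [i] \<in> A}"
    using assms[unfolded locally_finite_def, THEN spec[of _ "[]"]] by simp
  ultimately show "\<exists>n. thin n A"
    using thin_SucI[of A j] by simp
qed

section \<open>From nodes back to two-element edges\<close>

definition parent_edge :: "nat list \<Rightarrow> nat list set" where
  "parent_edge v = {butlast v, v}"

lemma butlast_neq: "v \<noteq> [] \<Longrightarrow> butlast v \<noteq> v"
  by (metis append_butlast_last_id append_self_conv not_Cons_self2)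

text \<open>Of the two ends of an edge the child is the longer list.\<close>

lemma inj_on_parent_edge: "inj_on parent_edge {v. v \<noteq> []}"
proof (rule inj_onI)
  fix v w :: "nat list" assume "v \<in> {v. v \<noteq> []}" "w \<in> {v. v \<noteq> []}" "parent_edge v = parent_edge w"
  then have "v = w \<or> (v = butlast w \<and> w = butlast v)" "v \<noteq> []"
    by (auto simp: parent_edge_def doubleton_eq_iff)
  moreover have False if "v = butlast w" "w = butlast v" "v \<noteq> []"
    using that by (metis butlast_neq length_butlast diff_le_self le_antisym append_butlast_last_id
        diff_less length_greater_0_conv less_irrefl less_le_trans less_one)
  ultimately show "v = w" by blast
qed

lemma component_parent_edge:
  assumes "[] \<notin> A"
  shows "component (parent_edge ` A) [] = cluster A"
proof
  let ?R = "{(u, w). {u, w} \<in> parent_edge ` A}"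
  have "v \<in> cluster A" if "([], v) \<in> ?R\<^sup>*" for v
    using that
  proof (induction rule: rtrancl_induct)
    case (step v w)
    then obtain a where a: "a \<in> A" "{v, w} = {butlast a, a}"
      by (auto simp: parent_edge_def)
    then have "a \<noteq> []" using assms by auto
    then obtain u i where u: "a = u @ [i]"
      by (metis append_butlast_last_id)
    with a have "v = u \<and> w = u @ [i] \<or> v = u @ [i] \<and> w = u"
      by (auto simp: doubleton_eq_iff)
    then show ?case
      using step.IH a(1) u by (elim disjE) simp_all
  qed simp
  then show "component (parent_edge ` A) [] \<subseteq> cluster A"
    by (auto simp: component_def)
  have "([], v) \<in> ?R\<^sup>*" if "v \<in> cluster A" for v
    using that
  proof (induction v rule: rev_induct)
    case (snoc i v)
    then have "(v, v @ [i]) \<in> ?R"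
      by (auto simp: parent_edge_def intro!: image_eqI[of _ _ "v @ [i]"])
    then show ?case
      using snoc by (auto intro: rtrancl.rtrancl_into_rtrancl)
  qed simp
  then show "cluster A \<subseteq> component (parent_edge ` A) []"
    by (auto simp: component_def)
qed

section \<open>Family trees and the recursion for Breaker's win\<close>

definition descendants :: "(nat list \<Rightarrow> nat) \<Rightarrow> nat list set" where
  "descendants c = family_tree c - {[]}"

lemma snoc_in_family_tree: "v @ [i] \<in> family_tree c \<longleftrightarrow> v \<in> family_tree c \<and> i < c v"
  by (subst family_tree.simps) auto

lemma Cons_in_family_tree:
  "i # v \<in> family_tree c \<longleftrightarrow> i < c [] \<and> v \<in> family_tree (\<lambda>w. c (i # w))"
proof (induction v rule: rev_induct)
  case Nil
  then show ?case
    using snoc_in_family_tree[of "[]" i c] by (simp add: family_tree.root)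
next
  case (snoc j v)
  then show ?case
    using snoc_in_family_tree[of "i # v" j c] by (auto simp: snoc_in_family_tree)
qed

lemma singleton_in_descendants [simp]: "[i] \<in> descendants c \<longleftrightarrow> i < c []"
  by (simp add: descendants_def Cons_in_family_tree family_tree.root)

lemma subtree_descendants:
  "i < c [] \<Longrightarrow> subtree [i] (descendants c) = descendants (\<lambda>w. c (i # w))"
  by (auto simp: subtree_def descendants_def Cons_in_family_tree)

lemma locally_finite_descendants: "locally_finite (descendants c)"
proof -
  have "{i. v @ [i] \<in> descendants c} \<subseteq> {..<c v}" for v
    by (auto simp: descendants_def snoc_in_family_tree)
  then show ?thesis
    unfolding locally_finite_def by (meson finite_lessThan finite_subset)
qed

lemma Nil_notin_descendants [simp]: "[] \<notin> descendants c"
  by (simp add: descendants_def)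

lemma family_tree_edges_eq: "family_tree_edges c = parent_edge ` descendants c"
proof
  show "family_tree_edges c \<subseteq> parent_edge ` descendants c"
  proof
    fix e assume "e \<in> family_tree_edges c"
    then obtain v i where "e = {v, v @ [i]}" "v \<in> family_tree c" "i < c v"
      by (auto simp: family_tree_edges_def)
    then show "e \<in> parent_edge ` descendants c"
      by (intro image_eqI[of _ _ "v @ [i]"]) (auto simp: parent_edge_def descendants_def snoc_in_family_tree)
  qed
  show "parent_edge ` descendants c \<subseteq> family_tree_edges c"
  proof
    fix e assume "e \<in> parent_edge ` descendants c"
    then obtain v where v: "e = parent_edge v" "v \<in> family_tree c" "v \<noteq> []"
      by (auto simp: descendants_def)
    then obtain u i where "v = u @ [i]"
      by (metis append_butlast_last_id)
    with v show "e \<in> family_tree_edges c"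
      by (auto simp: parent_edge_def family_tree_edges_def snoc_in_family_tree)
  qed
qed

lemma breaker_wins_iff_win_cut_off:
  "breaker_wins (family_tree_edges c) [] s \<longleftrightarrow> win cut_off s (descendants c) {}"
proof -
  have "win (\<lambda>A. finite (component A [])) s (parent_edge ` descendants c) (parent_edge ` {})
      \<longleftrightarrow> win cut_off s (descendants c) {}"
  proof (rule win_image_iff[OF inj_on_parent_edge])
    show "finite (component (parent_edge ` A) []) \<longleftrightarrow> cut_off A" if "A \<subseteq> {v. v \<noteq> []}" for A
    proof -
      have "[] \<notin> A" using that by blast
      then show ?thesis by (simp add: component_parent_edge)
    qed
  qed (auto simp: descendants_def)
  then show ?thesis
    by (simp add: breaker_wins_iff_win[OF finite_component] family_tree_edges_eq)
qed

lemma breaker_wins_Breaker_iff: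
  "breaker_wins (family_tree_edges c) [] Breaker \<longleftrightarrow> (\<exists>n. thin n (descendants c))"
  by (simp add: breaker_wins_iff_win_cut_off win_Breaker_iff locally_finite_descendants)

lemma breaker_wins_Breaker_step:
  "breaker_wins (family_tree_edges c) [] Breaker \<longleftrightarrow>
    (\<exists>j. \<forall>i<c []. i \<noteq> j \<longrightarrow> breaker_wins (family_tree_edges (\<lambda>v. c (i # v))) [] Breaker)"
  unfolding breaker_wins_Breaker_iff
  by (subst thin_iff[OF locally_finite_descendants]) (simp add: subtree_descendants)

lemma breaker_wins_Maker_step:
  "breaker_wins (family_tree_edges c) [] Maker \<longleftrightarrow>
    (\<forall>i<c []. breaker_wins (family_tree_edges (\<lambda>v. c (i # v))) [] Breaker)"
  unfolding breaker_wins_Breaker_iff breaker_wins_iff_win_cut_off[of _ Maker]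
  by (simp add: win_Maker_iff locally_finite_descendants subtree_descendants)

section \<open>Galton-Watson trees\<close>

lemma measurable_branch:
  "(\<lambda>c v. c (i # v)) \<in> (\<Pi>\<^sub>M v\<in>UNIV. count_space UNIV) \<rightarrow>\<^sub>M (\<Pi>\<^sub>M v\<in>UNIV. count_space UNIV)"
proof (rule measurable_PiM_single')
  show "(\<lambda>c. c (i # v)) \<in> (\<Pi>\<^sub>M v\<in>UNIV. count_space UNIV) \<rightarrow>\<^sub>M count_space UNIV" for v
    by (rule measurable_component_singleton) simp
qed simp

text \<open>For fixed \<open>n\<close> the recursion unfolds to finitely many quantifiers over
  natural numbers.\<close>

lemma measurable_thin:
  "Measurable.pred (\<Pi>\<^sub>M v\<in>UNIV. count_space UNIV) (\<lambda>c. thin n (descendants c))"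
proof (induction n)
  case (Suc n)
  have [measurable]: "Measurable.pred (\<Pi>\<^sub>M v\<in>UNIV. count_space UNIV)
      (\<lambda>c. thin n (descendants (\<lambda>v. c (i # v))))" for i
    using measurable_compose[OF measurable_branch Suc] .
  have [measurable]: "(\<lambda>c. c []) \<in> (\<Pi>\<^sub>M v\<in>(UNIV :: nat list set). count_space (UNIV :: nat set)) \<rightarrow>\<^sub>M count_space UNIV"
    by (rule measurable_component_singleton) simp
  have "thin (Suc n) (descendants c) \<longleftrightarrow>
      (\<exists>j. \<forall>i. i < c [] \<longrightarrow> i \<noteq> j \<longrightarrow> thin n (descendants (\<lambda>v. c (i # v))))" for c
    by (simp add: subtree_descendants)
  then show ?case
    by simp
qed simp

text \<open>The definition quantifies over strategies, in general uncountably many; the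
  characterisation by \<open>thin\<close> leaves a countable union over heights.\<close>

lemma measurable_breaker_wins:
  "Measurable.pred (\<Pi>\<^sub>M v\<in>UNIV. count_space UNIV)
    (\<lambda>c. breaker_wins (family_tree_edges c) [] Breaker)"
proof -
  note measurable_thin [measurable]
  show ?thesis
    unfolding breaker_wins_Breaker_iff by measurable
qed

section \<open>The generating function and its derivative\<close>

lemma pmf_sums_one: "pmf \<xi> sums 1" for \<xi> :: "nat pmf"
proof -
  have "(\<lambda>k. measure (measure_pmf \<xi>) {k}) sums measure (measure_pmf \<xi>) (\<Union>k. {k})"
    by (rule measure_pmf.finite_measure_UNION) (auto simp: disjoint_family_on_def)
  then show ?thesis
    by (simp add: measure_pmf_single)
qed

text \<open>The boundary is included because \<open>p\<close> may be 1.\<close>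

lemma pgf_sums: "\<bar>x\<bar> \<le> 1 \<Longrightarrow> (\<lambda>k. pmf \<xi> k * x ^ k) sums pgf \<xi> x"
proof -
  assume x: "\<bar>x\<bar> \<le> 1"
  have "summable (pmf \<xi>)"
    using pmf_sums_one by (rule sums_summable)
  then have "summable (\<lambda>k. pmf \<xi> k * x ^ k)"
    by (rule summable_comparison_test[rotated])
      (use x in \<open>auto simp: abs_mult power_abs intro!: exI[of _ 0] mult_left_le power_le_one\<close>)
  then show ?thesis
    unfolding pgf_def by (rule summable_sums)
qed

lemma deriv_pgf_sums:
  assumes "\<bar>x\<bar> < 1"
  shows "(\<lambda>k. pmf \<xi> k * (real k * x ^ (k - 1))) sums deriv (pgf \<xi>) x"
proof -
  have sm: "summable (\<lambda>k. pmf \<xi> k * z ^ k)" if "norm z < 1" for z :: real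
    using pgf_sums[of z \<xi>] that by (auto intro: sums_summable)
  have "(pgf \<xi> has_field_derivative (\<Sum>k. diffs (pmf \<xi>) k * x ^ k)) (at x)"
    unfolding pgf_def [abs_def] by (rule termdiffs_strong'[where K = 1]) (use sm assms in auto)
  then have d: "deriv (pgf \<xi>) x = (\<Sum>k. diffs (pmf \<xi>) k * x ^ k)"
    by (rule DERIV_imp_deriv)
  have "summable (\<lambda>k. diffs (pmf \<xi>) k * x ^ k)"
    using termdiff_converges[of x 1 "pmf \<xi>"] sm assms by auto
  then have "(\<lambda>k. diffs (pmf \<xi>) k * x ^ k) sums deriv (pgf \<xi>) x"
    unfolding d by (rule summable_sums)
  then have "(\<lambda>k. pmf \<xi> (Suc k) * (real (Suc k) * x ^ (Suc k - 1))) sums deriv (pgf \<xi>) x"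
    by (simp add: diffs_def ac_simps)
  \<comment> \<open>The shift adds the term for \<open>k = 0\<close>, which vanishes through the
    factor \<open>real k\<close>, whatever the truncated exponent.\<close>
  then show ?thesis
    by (subst (asm) sums_Suc_iff) simp
qed

section \<open>Independence of the branches\<close>

text \<open>
  Index \<open>0\<close> stands for the number of children of the root and index \<open>Suc i\<close> for branch \<open>i\<close>, so that a
  single independent family carries both.
\<close>

definition branch_labels :: "nat \<Rightarrow> nat list set" where
  "branch_labels m = (case m of 0 \<Rightarrow> {[]} | Suc i \<Rightarrow> range ((#) i))"

definition branch_outcome :: "nat \<Rightarrow> (nat list \<Rightarrow> nat) \<Rightarrow> nat" where
  "branch_outcome m c = (case m of 0 \<Rightarrow> c []
    | Suc i \<Rightarrow> of_bool (breaker_wins (family_tree_edges (\<lambda>v. c (i # v))) [] Breaker))"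

lemma measurable_branch_outcome:
  "branch_outcome m \<in> (\<Pi>\<^sub>M v\<in>branch_labels m. count_space UNIV) \<rightarrow>\<^sub>M count_space UNIV"
proof (cases m)
  case 0
  have "(\<lambda>c. c []) \<in> (\<Pi>\<^sub>M v\<in>{[]}. count_space UNIV) \<rightarrow>\<^sub>M count_space (UNIV :: nat set)"
    by (rule measurable_component_singleton) simp
  with 0 show ?thesis
    by (simp add: branch_outcome_def [abs_def] branch_labels_def)
next
  case (Suc i)
  have "(\<lambda>c v. c (i # v)) \<in> (\<Pi>\<^sub>M v\<in>branch_labels m. count_space UNIV) \<rightarrow>\<^sub>M
      (\<Pi>\<^sub>M v\<in>UNIV. count_space (UNIV :: nat set))"
    by (rule measurable_PiM_single')
      (auto simp: space_PiM Suc branch_labels_def intro: measurable_component_singleton)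
  from measurable_compose[OF this measurable_breaker_wins]
  have "Measurable.pred (\<Pi>\<^sub>M v\<in>branch_labels m. count_space UNIV)
    (\<lambda>c. breaker_wins (family_tree_edges (\<lambda>v. c (i # v))) [] Breaker)" .
  from measurable_compose[OF this, of of_bool "count_space (UNIV :: nat set)"]
  show ?thesis
    by (simp add: branch_outcome_def [abs_def] Suc)
qed

locale gw_tree =
  fixes M :: "'a measure" and X :: "nat list \<Rightarrow> 'a \<Rightarrow> nat" and \<xi> :: "nat pmf"
  assumes gw: "galton_watson M X \<xi>"
begin

sublocale prob_space M
  using gw by (simp add: galton_watson_def)

lemma indep: "indep_vars (\<lambda>_. count_space UNIV) X UNIV"
  and distr_X: "distr M (count_space UNIV) (X v) = measure_pmf \<xi>"
  using gw by (auto simp: galton_watson_def)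

lemma measurable_X [measurable]: "X v \<in> M \<rightarrow>\<^sub>M count_space UNIV"
  using indep by (simp add: indep_vars_def)

text \<open>Defined for every \<open>i\<close>, even beyond the number of children of the root,
  which makes it independent of that number.\<close>

definition good :: "nat \<Rightarrow> 'a \<Rightarrow> bool" where
  "good i \<omega> \<longleftrightarrow> breaker_wins (family_tree_edges (\<lambda>v. X (i # v) \<omega>)) [] Breaker"

abbreviation p :: real where
  "p \<equiv> measure M (breaker_event M X Breaker)"

text \<open>The sets \<open>branch_labels m\<close> are disjoint, so grouping the independent
  variables \<open>X v\<close> by them keeps the groups independent.\<close>

lemma indep_outcomes:
  "indep_vars (\<lambda>_. count_space UNIV) (\<lambda>m \<omega>. branch_outcome m (\<lambda>v. X v \<omega>)) UNIV"
proof -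
  have "disjoint_family branch_labels"
    by (auto simp: disjoint_family_on_def branch_labels_def split: nat.splits)
  then have "indep_vars (\<lambda>m. PiM (branch_labels m) (\<lambda>_. count_space UNIV))
      (\<lambda>m \<omega>. \<lambda>v\<in>branch_labels m. X v \<omega>) UNIV"
    by (intro indep_vars_restrict[OF indep]) auto
  then have "indep_vars (\<lambda>_. count_space UNIV)
      (\<lambda>m \<omega>. branch_outcome m (\<lambda>v\<in>branch_labels m. X v \<omega>)) UNIV"
    by (rule indep_vars_compose2) (rule measurable_branch_outcome)
  moreover have "branch_outcome m (\<lambda>v\<in>branch_labels m. X v \<omega>) = branch_outcome m (\<lambda>v. X v \<omega>)" for m \<omega>
    by (auto simp: branch_outcome_def branch_labels_def split: nat.split)
  ultimately show ?thesis by simp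
qed

text \<open>An injective relabelling keeps the variables independent and identically distributed.
  Applied to the identity and to \<open>(#) i\<close>, this gives branch \<open>i\<close> the law of
  the whole tree.\<close>

lemma distr_labels:
  assumes "inj f"
  shows "distr M (\<Pi>\<^sub>M v\<in>UNIV. count_space UNIV) (\<lambda>\<omega> v. X (f v) \<omega>)
    = (\<Pi>\<^sub>M v\<in>(UNIV :: nat list set). measure_pmf \<xi>)"
proof -
  have "indep_vars (\<lambda>v. PiM {f v} (\<lambda>_. count_space UNIV)) (\<lambda>v \<omega>. \<lambda>u\<in>{f v}. X u \<omega>) UNIV"
    by (rule indep_vars_restrict[OF indep])
      (use assms in \<open>auto simp: disjoint_family_on_def inj_eq\<close>)
  then have "indep_vars (\<lambda>_. count_space UNIV) (\<lambda>v \<omega>. (\<lambda>u\<in>{f v}. X u \<omega>) (f v)) UNIV"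
    by (rule indep_vars_compose2) (auto intro: measurable_component_singleton)
  then have "indep_vars (\<lambda>_. count_space UNIV) (\<lambda>v. X (f v)) UNIV"
    by simp
  then show ?thesis
    by (subst (asm) indep_vars_iff_distr_eq_PiM') (simp_all add: distr_X restrict_UNIV)
qed

lemma measurable_labels:
  "(\<lambda>\<omega> v. X (f v) \<omega>) \<in> M \<rightarrow>\<^sub>M (\<Pi>\<^sub>M v\<in>(UNIV :: nat list set). count_space UNIV)"
  by (rule measurable_PiM_single') simp_all

lemma breaker_event_sets: "breaker_event M X Breaker \<in> sets M"
  using measurable_compose[OF measurable_labels[of "\<lambda>v. v"] measurable_breaker_wins]
  by (simp add: breaker_event_def pred_def)

lemma measurable_good [measurable]: "Measurable.pred M (good i)"
  using measurable_compose[OF measurable_labels[of "(#) i"] measurable_breaker_wins]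
  by (simp add: good_def [abs_def])

lemma prob_good: "prob {\<omega> \<in> space M. good i \<omega>} = p"
proof -
  let ?N = "\<Pi>\<^sub>M v\<in>(UNIV :: nat list set). count_space (UNIV :: nat set)"
  let ?B = "{c \<in> space ?N. breaker_wins (family_tree_edges c) [] Breaker}"
  have B: "?B \<in> sets ?N"
    using measurable_breaker_wins by (simp add: pred_def)
  have sp: "(\<lambda>v. X (f v) \<omega>) \<in> space ?N" for f :: "nat list \<Rightarrow> nat list" and \<omega>
    by (simp add: space_PiM)
  have "prob {\<omega> \<in> space M. breaker_wins (family_tree_edges (\<lambda>v. X (f v) \<omega>)) [] Breaker}
      = measure (\<Pi>\<^sub>M v\<in>(UNIV :: nat list set). measure_pmf \<xi>) ?B" if "inj f" for f
    unfolding distr_labels[OF that, symmetric]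
    by (subst measure_distr[OF measurable_labels B])
      (auto intro!: arg_cong[where f = prob] simp: sp)
  from this[of "\<lambda>v. v"] this[of "(#) i"] show ?thesis
    by (simp add: breaker_event_def good_def)
qed

text \<open>\<open>J\<close> prescribes the bad branches. With \<open>k\<close> fixed, the event
  concerns only the independent outcomes with indices \<open>0\<close> to \<open>k\<close>.\<close>

lemma prob_pattern:
  "prob {\<omega> \<in> space M. X [] \<omega> = k \<and> (\<forall>i<k. good i \<omega> \<longleftrightarrow> i \<notin> J)}
    = pmf \<xi> k * (\<Prod>i<k. if i \<in> J then 1 - p else p)"
proof -
  define Y where "Y m \<omega> = branch_outcome m (\<lambda>v. X v \<omega>)" for m \<omega>
  define A where "A m = (case m of 0 \<Rightarrow> {k} | Suc i \<Rightarrow> {of_bool (i \<notin> J)})" for m :: nat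
  have Y0: "Y 0 -` A 0 \<inter> space M = {\<omega> \<in> space M. X [] \<omega> = k}"
    by (auto simp: Y_def A_def branch_outcome_def)
  have YS: "Y (Suc i) -` A (Suc i) \<inter> space M = {\<omega> \<in> space M. good i \<omega> \<longleftrightarrow> i \<notin> J}" for i
    by (auto simp: Y_def A_def branch_outcome_def good_def of_bool_def split: if_splits)
  have "prob (Y 0 -` A 0 \<inter> space M) = measure (distr M (count_space UNIV) (X [])) {k}"
    by (subst measure_distr) (auto simp: Y0 intro!: arg_cong[where f = prob])
  then have P0: "prob (Y 0 -` A 0 \<inter> space M) = pmf \<xi> k"
    by (simp add: distr_X pmf.rep_eq)
  have PS: "prob (Y (Suc i) -` A (Suc i) \<inter> space M) = (if i \<in> J then 1 - p else p)" for i
  proof (cases "i \<in> J")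
    case True
    have "prob {\<omega> \<in> space M. \<not> good i \<omega>} = 1 - prob {\<omega> \<in> space M. good i \<omega>}"
      by (rule prob_neg) simp
    then show ?thesis
      using True by (simp add: YS prob_good)
  qed (simp add: YS prob_good)
  have "prob (\<Inter>m\<in>{..k}. Y m -` A m \<inter> space M) = (\<Prod>m\<in>{..k}. prob (Y m -` A m \<inter> space M))"
    by (rule indep_varsD[OF indep_outcomes[folded Y_def]]) auto
  also have "\<dots> = pmf \<xi> k * (\<Prod>i<k. if i \<in> J then 1 - p else p)"
    by (simp add: prod.atMost_shift P0 PS)
  also have "(\<Inter>m\<in>{..k}. Y m -` A m \<inter> space M)
      = (Y 0 -` A 0 \<inter> space M) \<inter> (\<Inter>i\<in>{..<k}. Y (Suc i) -` A (Suc i) \<inter> space M)"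
  proof -
    have "{..k} = insert 0 (Suc ` {..<k})"
      by (cases k) (auto simp: lessThan_Suc_atMost atMost_Suc_eq_insert_0)
    then show ?thesis by auto
  qed
  also have "\<dots> = {\<omega> \<in> space M. X [] \<omega> = k \<and> (\<forall>i<k. good i \<omega> \<longleftrightarrow> i \<notin> J)}"
    unfolding Y0 YS by auto
  finally show ?thesis .
qed

section \<open>The two equations\<close>

lemma prob_all_good:
  "prob {\<omega> \<in> space M. X [] \<omega> = k \<and> (\<forall>i<k. good i \<omega>)} = pmf \<xi> k * p ^ k"
  using prob_pattern[of k "{}"] by simp

text \<open>The \<open>k\<close> choices of the bad branch give disjoint events of equal
  probability.\<close>

lemma prob_one_bad:
  "prob {\<omega> \<in> space M. X [] \<omega> = k \<and> (\<exists>j<k. \<forall>i<k. good i \<omega> \<longleftrightarrow> i \<noteq> j)}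
    = (1 - p) * (pmf \<xi> k * (real k * p ^ (k - 1)))"
proof -
  define A where "A j = {\<omega> \<in> space M. X [] \<omega> = k \<and> (\<forall>i<k. good i \<omega> \<longleftrightarrow> i \<notin> {j})}" for j
  have A: "prob (A j) = pmf \<xi> k * ((1 - p) * p ^ (k - 1))" if "j < k" for j
  proof -
    have "(\<Prod>i<k. if i \<in> {j} then 1 - p else p) = (\<Prod>i\<in>insert j ({..<k} - {j}). if i \<in> {j} then 1 - p else p)"
      using that by (simp add: insert_absorb)
    also have "\<dots> = (1 - p) * (\<Prod>i\<in>{..<k} - {j}. p)"
      by (subst prod.insert) (auto intro!: prod.cong)
    also have "\<dots> = (1 - p) * p ^ (k - 1)"
      using that by simp
    finally show ?thesis
      unfolding A_def prob_pattern by simp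
  qed
  have "{\<omega> \<in> space M. X [] \<omega> = k \<and> (\<exists>j<k. \<forall>i<k. good i \<omega> \<longleftrightarrow> i \<noteq> j)} = (\<Union>j\<in>{..<k}. A j)"
    by (auto simp: A_def)
  also have "prob \<dots> = (\<Sum>j<k. prob (A j))"
  proof (rule finite_measure_finite_Union)
    show "A ` {..<k} \<subseteq> events"
      unfolding A_def by auto
    show "disjoint_family_on A {..<k}"
      by (fastforce simp: disjoint_family_on_def A_def)
  qed simp
  also have "\<dots> = (1 - p) * (pmf \<xi> k * (real k * p ^ (k - 1)))"
    by (simp add: A)
  finally show ?thesis .
qed

lemma sums_prob:
  assumes [measurable]: "Measurable.pred M Q"
  shows "(\<lambda>k. prob {\<omega> \<in> space M. X [] \<omega> = k \<and> Q \<omega>}) sums prob {\<omega> \<in> space M. Q \<omega>}"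
proof -
  have "(\<lambda>k. prob {\<omega> \<in> space M. X [] \<omega> = k \<and> Q \<omega>})
      sums prob (\<Union>k. {\<omega> \<in> space M. X [] \<omega> = k \<and> Q \<omega>})"
    by (rule finite_measure_UNION) (auto simp: disjoint_family_on_def)
  moreover have "(\<Union>k. {\<omega> \<in> space M. X [] \<omega> = k \<and> Q \<omega>}) = {\<omega> \<in> space M. Q \<omega>}"
    by auto
  ultimately show ?thesis by simp
qed

lemma sums_prob_all_good:
  "(\<lambda>k. pmf \<xi> k * p ^ k) sums prob {\<omega> \<in> space M. \<forall>i<X [] \<omega>. good i \<omega>}"
proof -
  have "{\<omega> \<in> space M. X [] \<omega> = k \<and> (\<forall>i<X [] \<omega>. good i \<omega>)}
      = {\<omega> \<in> space M. X [] \<omega> = k \<and> (\<forall>i<k. good i \<omega>)}" for k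
    by auto
  then show ?thesis
    using sums_prob[of "\<lambda>\<omega>. \<forall>i<X [] \<omega>. good i \<omega>"] by (simp add: prob_all_good)
qed

lemma Maker_event_eq: "breaker_event M X Maker = {\<omega> \<in> space M. \<forall>i<X [] \<omega>. good i \<omega>}"
  unfolding breaker_event_def good_def breaker_wins_Maker_step ..

lemma Breaker_event_eq:
  "breaker_event M X Breaker = {\<omega> \<in> space M. \<forall>i<X [] \<omega>. good i \<omega>} \<union>
    {\<omega> \<in> space M. \<exists>j<X [] \<omega>. \<forall>i<X [] \<omega>. good i \<omega> \<longleftrightarrow> i \<noteq> j}"
proof -
  \<comment> \<open>At most one exception means none or exactly one; a \<open>j\<close> beyond the
    range exempts nothing. The two cases exclude each other, so their probabilities can be
    added.\<close>
  have "(\<exists>j. \<forall>i<n. i \<noteq> j \<longrightarrow> P i) \<longleftrightarrow> (\<forall>i<n. P i) \<or> (\<exists>j<n. \<forall>i<n. P i \<longleftrightarrow> i \<noteq> j)"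
    for n :: nat and P
    by metis
  then show ?thesis
    unfolding breaker_event_def good_def by (subst breaker_wins_Breaker_step) auto
qed

lemma pbar_eq: "measure M (breaker_event M X Maker) = pgf \<xi> p"
  using sums_unique2[OF sums_prob_all_good pgf_sums] unfolding Maker_event_eq
  by (simp add: measure_nonneg)

lemma p_eq: "p = pgf \<xi> p + (1 - p) * deriv (pgf \<xi>) p"
proof (cases "p = 1")
  case True
  \<comment> \<open>The derivative need not exist at 1, but its factor \<open>1 - p\<close> is 0
    there.\<close>
  have "pgf \<xi> 1 = 1"
    using sums_unique2[OF pgf_sums[of 1 \<xi>]] pmf_sums_one[of \<xi>] by simp
  then show ?thesis
    unfolding True by simp
next
  case False
  then have p: "\<bar>p\<bar> < 1"
    using prob_le_1[of "breaker_event M X Breaker"] by (simp add: measure_nonneg less_le)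
  let ?one = "{\<omega> \<in> space M. \<exists>j<X [] \<omega>. \<forall>i<X [] \<omega>. good i \<omega> \<longleftrightarrow> i \<noteq> j}"
  have "{\<omega> \<in> space M. X [] \<omega> = k \<and> (\<exists>j<X [] \<omega>. \<forall>i<X [] \<omega>. good i \<omega> \<longleftrightarrow> i \<noteq> j)}
      = {\<omega> \<in> space M. X [] \<omega> = k \<and> (\<exists>j<k. \<forall>i<k. good i \<omega> \<longleftrightarrow> i \<noteq> j)}" for k
    by auto
  then have "(\<lambda>k. (1 - p) * (pmf \<xi> k * (real k * p ^ (k - 1)))) sums prob ?one"
    using sums_prob[of "\<lambda>\<omega>. \<exists>j<X [] \<omega>. \<forall>i<X [] \<omega>. good i \<omega> \<longleftrightarrow> i \<noteq> j"]
    by (simp add: prob_one_bad)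
  moreover have "(\<lambda>k. (1 - p) * (pmf \<xi> k * (real k * p ^ (k - 1)))) sums ((1 - p) * deriv (pgf \<xi>) p)"
    by (rule sums_mult[OF deriv_pgf_sums[OF p]])
  ultimately have one: "prob ?one = (1 - p) * deriv (pgf \<xi>) p"
    by (rule sums_unique2)
  have "p = prob {\<omega> \<in> space M. \<forall>i<X [] \<omega>. good i \<omega>} + prob ?one"
    unfolding Breaker_event_eq by (rule finite_measure_Union) auto
  then show ?thesis
    using pbar_eq one unfolding Maker_event_eq by linarith
qed

lemma Maker_event_sets: "breaker_event M X Maker \<in> sets M"
  unfolding Maker_event_eq by simp

end

text \<open>Measurability is part of the conclusion because \<open>measure\<close> is 0 by
  convention on sets outside \<open>sets M\<close>; only with it are \<open>p\<close> and
  \<open>pbar\<close> genuine probabilities.\<close>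

theorem theorem4p3:
  fixes \<xi> :: "nat pmf"
    and M :: "'a measure"
    and X :: "nat list \<Rightarrow> 'a \<Rightarrow> nat"
    and p pbar :: real
  assumes gw: "galton_watson M X \<xi>"
    and p: "p = measure M (breaker_event M X Breaker)"
    and pbar: "pbar = measure M (breaker_event M X Maker)"
  shows "breaker_event M X Breaker \<in> sets M \<and>
    breaker_event M X Maker \<in> sets M \<and>
    p = pgf \<xi> p + (1 - p) * deriv (pgf \<xi>) p \<and>
    pbar = pgf \<xi> p"
proof -
  interpret gw_tree M X \<xi>
    using gw by unfold_locales
  show ?thesis
    unfolding p pbar using breaker_event_sets Maker_event_sets p_eq pbar_eq by blast
qed

end
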